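(* Let $\Lambda_0>0$, $\alpha\in(0,1)$, $\gamma>0$, $\beta\in(0,1)$, and let $$\tilde\lambda(s)=\frac{\Lambda_0}{s}\,\frac{\gamma+s^{\beta}}{(1-\alpha)\gamma+s^{\beta}}.$$ Then the inverse Laplace transform of $\tilde\lambda$ is given, for $t\ge 0$, by $$\lambda(t)=\frac{\Lambda_0}{1-\alpha}-\frac{\alpha\Lambda_0}{1-\alpha}\,E_\beta\big((\alpha-1)\gamma t^\beta\big),$$ where $E_\beta$ is the one-parameter Mittag-Leffler function.
   Context: The Laplace transform of a function $f$ on $[0,\infty)$ is $\mathcal{L}\{f\}(s)=\int_0^\infty e^{-st}f(t)\,dt$. The inverse Laplace transform of $\tilde\lambda$ denotes the continuous function on $[0,\infty)$ whose Laplace transform equals $\tilde\lambda(s)$ for all sufficiently large real $s$. The three-parameter Mittag-Leffler (Prabhakar) function is $$E_{a,b}^c(z)=\frac{1}{\Gamma(c)}\sum_{k=0}^\infty\frac{\Gamma(c+k)\,z^k}{k!\,\Gamma(ak+b)},\qquad \mathrm{Re}(a)>0,$$ and the one-parameter Mittag-Leffler function is $E_\beta(z):=E_{\beta,1}^1(z)=\sum_{k=0}^\infty\frac{z^k}{\Gamma(\beta k+1)}$. *)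

theory Defs
  imports "HOL-Analysis.Analysis"
begin

text \<open>For continuous \<open>f\<close>, the Henstock--Kurzweil integral over \<open>{0..}\<close> is exactly the improper
  Riemann integral, so conditionally convergent Laplace integrals are covered.\<close>

definition laplace_transform :: "(real \<Rightarrow> real) \<Rightarrow> real \<Rightarrow> real" where
  "laplace_transform f s = integral {0..} (\<lambda>t. exp (- s * t) * f t)"

text \<open>Integrability is required explicitly because \<open>integral\<close> is 0 when the integral does not exist.\<close>

definition laplace_preimage :: "(real \<Rightarrow> real) \<Rightarrow> (real \<Rightarrow> real) \<Rightarrow> bool" where
  "laplace_preimage F f \<longleftrightarrow>
     continuous_on {0..} f \<and>
     (\<forall>\<^sub>F s in at_top. (\<lambda>t. exp (- s * t) * f t) integrable_on {0..} \<and>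
                    laplace_transform f s = F s)"

text \<open>\<open>f\<close> is \<^emph>\<open>the\<close> continuous function on \<open>{0..}\<close> with Laplace transform \<open>F\<close>: the second conjunct
  is the uniqueness part of the definite description. Values at negative arguments are irrelevant.\<close>

definition is_inverse_laplace :: "(real \<Rightarrow> real) \<Rightarrow> (real \<Rightarrow> real) \<Rightarrow> bool" where
  "is_inverse_laplace F f \<longleftrightarrow>
     laplace_preimage F f \<and> (\<forall>g. laplace_preimage F g \<longrightarrow> (\<forall>t\<ge>0. g t = f t))"

text \<open>Parameters and argument may be real or complex; the series is meant for \<open>a\<close> with positive real
  part and \<open>c\<close> not a pole of \<open>Gamma\<close>. A term where \<open>a * k + b\<close> is a pole vanishes, since \<open>Gamma\<close> is 0
  at its poles and division by 0 gives 0; this agrees with \<open>1 / Gamma = 0\<close> there.\<close>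

definition prabhakar :: "'a::Gamma \<Rightarrow> 'a \<Rightarrow> 'a \<Rightarrow> 'a \<Rightarrow> 'a" where
  "prabhakar a b c z =
     1 / Gamma c * (\<Sum>k. Gamma (c + of_nat k) * z ^ k / (fact k * Gamma (a * of_nat k + b)))"

definition mittag_leffler :: "'a::Gamma \<Rightarrow> 'a \<Rightarrow> 'a" where
  "mittag_leffler \<beta> z = prabhakar \<beta> 1 1 z"

lemma mittag_leffler_series:
  fixes \<beta> z :: "'a::Gamma"
  shows "mittag_leffler \<beta> z = (\<Sum>k. z ^ k / Gamma (\<beta> * of_nat k + 1))"
  by (simp add: mittag_leffler_def prabhakar_def Gamma_fact)

end

(*
  Existence: integrating exp (- s t) t^(\<beta> k) gives Gamma values that cancel the coefficients of the
  Mittag-Leffler series, so summing termwise produces a geometric series in c / s^\<beta>.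

  Uniqueness (Lerch): let h be a difference of two preimages and K the antiderivative of
  exp (- s0 t) h(t) from 0. Integrating by parts, all exponential moments of K with positive integer
  exponents vanish. In the variable x = exp (- t), K is a continuous function on [0, 1] orthogonal
  to all polynomials, so Weierstrass approximation forces K = 0 and hence h = 0. The integrals of h
  may converge only conditionally, so everything is done with limits of integrals over [0, T].
*)
theory Submission
  imports Defs
begin

section \<open>Uniqueness: continuous functions with the same Laplace transform\<close>

text \<open>A gauge integral over an unbounded set is approximated by integrals over all boxes
  containing a large enough ball. This does not require absolute convergence, so conditionally
  convergent transforms can be handled through their truncations.\<close>

lemma integral_tendsto_at_top:
  fixes f :: "real \<Rightarrow> 'a::banach"
  assumes f: "f integrable_on {a..}"
  shows "((\<lambda>y. integral {a..y} f) \<longlongrightarrow> integral {a..} f) at_top"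
proof (rule tendstoI)
  fix e :: real assume "e > 0"
  have I: "(f has_integral integral {a..} f) {a..}"
    using f by (rule integrable_integral)
  obtain B where B: "\<And>u v. ball 0 B \<subseteq> cbox u v \<Longrightarrow>
      norm (integral (cbox u v) (\<lambda>x. if x \<in> {a..} then f x else 0) - integral {a..} f) < e"
    using I \<open>e > 0\<close> unfolding has_integral_alt'[of f] by meson
  show "\<forall>\<^sub>F y in at_top. dist (integral {a..y} f) (integral {a..} f) < e"
    using eventually_ge_at_top[of "max a (max B 0)"]
  proof eventually_elim
    case (elim y)
    \<comment> \<open>The box must reach down to \<open>- B\<close> to cover the ball; below
      \<open>a\<close> the restricted integrand is 0, so this adds nothing.\<close>
    define u where "u = min a (- B)"
    have "ball 0 B \<subseteq> cbox u y"
      using elim by (auto simp: u_def dist_real_def)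
    moreover have "integral (cbox u y) (\<lambda>x. if x \<in> {a..} then f x else 0) = integral {a..y} f"
    proof -
      have "{a..} \<inter> {u..y} = {a..y}"
        using elim by (auto simp: u_def)
      then show ?thesis
        by (simp only: cbox_interval integral_restrict_Int)
    qed
    ultimately show ?case
      using B by (metis dist_norm)
  qed
qed

text \<open>The substitution x = exp (- t) maps the half-line onto the half-open interval from 0 to
  1, and the limit at infinity supplies the value at the missing endpoint. On the resulting compact
  interval Weierstrass approximation applies.\<close>

lemma continuous_on_log_compactification:
  fixes K :: "real \<Rightarrow> real"
  assumes K: "continuous_on {0..} K" and lim: "(K \<longlongrightarrow> L) at_top"
  shows "continuous_on {0..1} (\<lambda>x. if x = 0 then L else K (- ln x))" (is "continuous_on _ ?G")
proof -
  have G0: "(?G \<longlongrightarrow> ?G 0) (at 0 within {0..1})"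
  proof -
    have "filterlim (\<lambda>x::real. - ln x) at_top (at_right 0)"
      using ln_at_0 by (simp add: filterlim_uminus_at_top)
    with lim have "((\<lambda>x. K (- ln x)) \<longlongrightarrow> L) (at_right 0)"
      by (rule filterlim_compose)
    then have "(?G \<longlongrightarrow> L) (at_right 0)"
      by (rule Lim_transform_eventually) (auto simp: eventually_at_filter)
    then show ?thesis
      by (simp add: at_within_Icc_at_right)
  qed
  have "continuous_on {0<..1} (\<lambda>x. K (- ln x))"
    by (rule continuous_on_compose2[OF K]) (auto intro!: continuous_intros)
  then have Gpos: "continuous_on {0<..1} ?G"
    by (rule continuous_on_eq) auto
  have "(?G \<longlongrightarrow> ?G x) (at x within {0..1})" if "x \<in> {0..1}" "x \<noteq> 0" for x
  proof -
    have "at x within {0..1} = at x within {0<..1}"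
      by (rule at_within_nhd[of x "{0<..}"]) (use that in auto)
    then show ?thesis
      using Gpos that unfolding continuous_on_def by auto
  qed
  with G0 show ?thesis
    unfolding continuous_on_def by blast
qed

text \<open>The exponents start at 1 because exp (- t) is the Jacobian of x = exp (- t): the n-th
  hypothesis says that the transformed function is orthogonal to x^n. Orthogonality to all
  polynomials makes its squared L2 norm, the limit of \<open>J\<close>, equal to 0.\<close>

lemma exp_moments_zero_imp_zero:
  fixes K :: "real \<Rightarrow> real"
  assumes K: "continuous_on {0..} K" and lim: "(K \<longlongrightarrow> L) at_top"
    and moments: "\<And>n::nat. ((\<lambda>T. integral {0..T} (\<lambda>t. exp (- real (Suc n) * t) * K t)) \<longlongrightarrow> 0) at_top"
    and "t \<ge> 0"
  shows "K t = 0"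
proof -
  define G where "G = (\<lambda>x. if x = 0 then L else K (- ln x))"
  have G: "continuous_on {0..1} G"
    unfolding G_def by (rule continuous_on_log_compactification[OF K lim])
  have KG: "K t = G (exp (- t))" for t
    by (simp add: G_def)
  have Kcont: "continuous_on {0..T} K" for T
    using K by (rule continuous_on_subset) auto
  have "bounded (G ` {0..1})"
    using G by (intro compact_imp_bounded compact_continuous_image) auto
  then obtain M where M: "M > 0" "\<And>x. x \<in> {0..1} \<Longrightarrow> \<bar>G x\<bar> \<le> M"
    by (auto simp: bounded_pos)
  define J where "J = (\<lambda>T. integral {0..T} (\<lambda>t. exp (- t) * (K t * K t)))"
  have J_int: "(\<lambda>t. exp (- t) * (K t * K t)) integrable_on {0..T}" for T
    by (intro integrable_continuous_interval continuous_intros Kcont)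
  have J_le: "J T \<le> e" if "e > 0" "T \<ge> 0" for e T
  proof -
    \<comment> \<open>Split \<open>K\<^sup>2 = K p + K (K - p)\<close> with \<open>p\<close> a polynomial in \<open>exp (- t)\<close> within \<open>e / M\<close> of \<open>K\<close>:
      the integral of the first part tends to 0 by the moment hypothesis.\<close>
    define d where "d = e / M"
    have "d > 0"
      using that M by (simp add: d_def)
    obtain p where p: "real_polynomial_function p" "\<And>x. x \<in> {0..1} \<Longrightarrow> \<bar>G x - p x\<bar> < d"
      using Stone_Weierstrass_real_polynomial_function[OF _ G \<open>d > 0\<close>] by auto
    then obtain a n where a: "p = (\<lambda>x. \<Sum>i\<le>n. a i * x ^ i)"
      using real_polynomial_function_iff_sum by blast
    define I where "I = (\<lambda>i T. integral {0..T} (\<lambda>t. exp (- real (Suc i) * t) * K t))"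
    have "J T \<le> (\<Sum>i\<le>n. a i * I i U) + e" if U: "U \<ge> T" for U
    proof -
      \<comment> \<open>The integrand of \<open>J\<close> is nonnegative, so \<open>T\<close> may
        stay fixed while \<open>U\<close> tends to infinity and the moments vanish.\<close>
      have "J T \<le> J U"
        unfolding J_def using U by (intro integral_subset_le J_int) auto
      also have "J U \<le> (\<Sum>i\<le>n. a i * I i U) + (e - e * exp (- U))"
      proof (rule has_integral_le)
        show "((\<lambda>t. exp (- t) * (K t * K t)) has_integral J U) {0..U}"
          unfolding J_def by (rule integrable_integral[OF J_int])
        have "((\<lambda>t. exp (- real (Suc i) * t) * K t) has_integral I i U) {0..U}" for i
          unfolding I_def
          by (intro integrable_integral integrable_continuous_interval continuous_intros Kcont)
        \<comment> \<open>The weight exp (- t) has total mass 1, so a pointwise error of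
          \<open>e\<close> costs at most \<open>e\<close>, uniformly in \<open>U\<close>.\<close>
        moreover have "((\<lambda>t. e * exp (- t)) has_integral (- e * exp (- U) - (- e * exp (- 0)))) {0..U}"
          using U \<open>T \<ge> 0\<close>
          by (intro fundamental_theorem_of_calculus)
             (auto intro!: derivative_eq_intros simp flip: has_real_derivative_iff_has_vector_derivative)
        ultimately show "((\<lambda>t. (\<Sum>i\<le>n. a i * (exp (- real (Suc i) * t) * K t)) + e * exp (- t))
            has_integral (\<Sum>i\<le>n. a i * I i U) + (e - e * exp (- U))) {0..U}"
          by (intro has_integral_add has_integral_sum has_integral_mult_right) auto
        fix t assume t: "t \<in> {0..U}"
        have x: "exp (- t) \<in> {0..1}"
          using t by auto
        have "(K t - p (exp (- t))) * K t \<le> \<bar>K t - p (exp (- t))\<bar> * \<bar>K t\<bar>"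
          by (metis abs_ge_self abs_mult)
        also have "\<dots> \<le> d * M"
          using p(2)[OF x] M(2)[OF x] by (intro mult_mono) (auto simp: KG[of t])
        finally have "K t * K t \<le> p (exp (- t)) * K t + e"
          using M(1) by (simp add: d_def algebra_simps)
        then have "exp (- t) * (K t * K t) \<le> exp (- t) * (p (exp (- t)) * K t + e)"
          by simp
        also have "exp (- t) * (p (exp (- t)) * K t + e) =
            exp (- t) * p (exp (- t)) * K t + e * exp (- t)"
          by (simp add: algebra_simps)
        also have "exp (- t) * p (exp (- t)) * K t = (\<Sum>i\<le>n. a i * (exp (- real (Suc i) * t) * K t))"
          unfolding a sum_distrib_left sum_distrib_right
          by (intro sum.cong refl) (simp add: exp_of_nat_mult[symmetric] exp_add[symmetric] algebra_simps)
        finally show "exp (- t) * (K t * K t) \<le>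
            (\<Sum>i\<le>n. a i * (exp (- real (Suc i) * t) * K t)) + e * exp (- t)" .
      qed
      also have "\<dots> \<le> (\<Sum>i\<le>n. a i * I i U) + e"
        using \<open>e > 0\<close> by simp
      finally show ?thesis .
    qed
    moreover have "((\<lambda>U. (\<Sum>i\<le>n. a i * I i U) + e) \<longlongrightarrow> (\<Sum>i\<le>n. a i * 0) + e) at_top"
      unfolding I_def by (intro tendsto_intros moments)
    ultimately show "J T \<le> e"
      by (intro tendsto_lowerbound[of "\<lambda>U. (\<Sum>i\<le>n. a i * I i U) + e" e at_top])
         (auto intro: eventually_mono[OF eventually_ge_at_top[of T]])
  qed
  \<comment> \<open>The extra 1 keeps the interval nondegenerate even for \<open>t = 0\<close>, so
    that a zero integral of a continuous nonnegative function forces it to vanish.\<close>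
  define T where "T = t + 1"
  have "T \<ge> 0"
    using \<open>t \<ge> 0\<close> by (simp add: T_def)
  then have "J T \<le> 0"
    by (auto intro: dense_ge[OF J_le])
  moreover have "J T \<ge> 0"
    unfolding J_def by (rule integral_nonneg[OF J_int]) simp
  ultimately have "integral {0..T} (\<lambda>t. exp (- t) * (K t * K t)) = 0"
    by (simp add: J_def)
  moreover have "continuous_on {0..T} (\<lambda>t. exp (- t) * (K t * K t))"
    by (intro continuous_intros Kcont)
  ultimately have "\<forall>t\<in>{0..T}. exp (- t) * (K t * K t) = 0"
    using \<open>t \<ge> 0\<close> integral_eq_0_iff[of 0 T "\<lambda>t. exp (- t) * (K t * K t)"] by (simp add: T_def)
  then show ?thesis
    using \<open>t \<ge> 0\<close> by (auto simp: T_def)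
qed

text \<open>The moment lemma is not applied to \<open>h\<close> itself, which may be unbounded and
  have no limit at infinity. The antiderivative \<open>K\<close> does have one: its limit is the
  transform at \<open>s0\<close>, which is 0.\<close>

lemma laplace_zero_imp_zero:
  fixes h :: "real \<Rightarrow> real"
  assumes h: "continuous_on {0..} h"
    and zero: "\<And>s. s \<ge> s0 \<Longrightarrow> ((\<lambda>t. exp (- s * t) * h t) has_integral 0) {0..}"
    and "t \<ge> 0"
  shows "h t = 0"
proof -
  define k where "k = (\<lambda>t. exp (- s0 * t) * h t)"
  define K where "K = (\<lambda>t. integral {0..t} k)"
  have hcont: "continuous_on {0..T} h" for T
    using h by (rule continuous_on_subset) auto
  have kcont: "continuous_on {0..T} k" for T
    unfolding k_def by (intro continuous_intros hcont)
  have K_deriv: "(K has_vector_derivative k t) (at t within {0..T})" if "t \<in> {0..T}" for t T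
    unfolding K_def by (rule integral_has_vector_derivative[OF kcont that])
  have Kcont: "continuous_on {0..T} K" for T
    using K_deriv by (intro continuous_on_vector_derivative)
  have tail: "((\<lambda>T. integral {0..T} (\<lambda>t. exp (- s * t) * h t)) \<longlongrightarrow> 0) at_top" if "s \<ge> s0" for s
    using integral_tendsto_at_top[OF has_integral_integrable[OF zero[OF that]]] zero[OF that]
    by (simp add: integral_unique)
  have K_lim: "(K \<longlongrightarrow> 0) at_top"
    using tail[of s0] by (simp add: K_def[abs_def] k_def[abs_def])
  have "K u = 0" if "u \<ge> 0" for u
  proof (rule exp_moments_zero_imp_zero[OF _ K_lim _ that])
    show "continuous_on {0..} K"
      unfolding continuous_on_eq_continuous_within
    proof
      fix x :: real assume "x \<in> {0..}"
      \<comment> \<open>Continuity is local, so the half-line can be replaced near \<open>x\<close>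
        by a compact interval with \<open>x\<close> away from its right end.\<close>
      moreover have "at x within {0..} = at x within {0..x + 1}"
        by (rule at_within_nhd[of x "{..<x + 1}"]) auto
      ultimately show "continuous (at x within {0..}) K"
        using Kcont[of "x + 1"] by (simp add: continuous_on_eq_continuous_within)
    qed
    fix n :: nat
    define c where "c = real (Suc n)"
    have c: "c > 0"
      by (simp add: c_def)
    define A where "A = (\<lambda>T. integral {0..T} (\<lambda>t. exp (- (s0 + c) * t) * h t))"
    \<comment> \<open>Integration by parts moves the derivative from \<open>K\<close> onto the
      exponential. The boundary term at 0 drops out since \<open>K 0 = 0\<close>, and
      \<open>A T\<close> is a truncated transform at \<open>s0 + c\<close>, so it tends to
      0.\<close>
    have parts: "integral {0..T} (\<lambda>t. exp (- c * t) * K t) = (A T - exp (- c * T) * K T) / c"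
      if "T \<ge> 0" for T
    proof -
      have "((\<lambda>t. exp (- c * t) * k t + (- c * exp (- c * t)) * K t) has_integral
          exp (- c * T) * K T - exp (- c * 0) * K 0) {0..T}"
      proof (rule fundamental_theorem_of_calculus[OF that])
        fix x assume x: "x \<in> {0..T}"
        have "((\<lambda>t. exp (- c * t)) has_vector_derivative - c * exp (- c * x)) (at x within {0..T})"
          by (auto intro!: derivative_eq_intros simp flip: has_real_derivative_iff_has_vector_derivative)
        from has_vector_derivative_mult[OF this K_deriv[OF x]]
        show "((\<lambda>t. exp (- c * t) * K t) has_vector_derivative
            exp (- c * x) * k x + - c * exp (- c * x) * K x) (at x within {0..T})" .
      qed
      moreover have "((\<lambda>t. exp (- c * t) * k t) has_integral A T) {0..T}"
      proof -
        have "((\<lambda>t. exp (- (s0 + c) * t) * h t) has_integral A T) {0..T}"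
          unfolding A_def
          by (intro integrable_integral integrable_continuous_interval continuous_intros hcont)
        then show ?thesis
          by (rule has_integral_eq[rotated]) (simp add: k_def exp_add[symmetric] algebra_simps)
      qed
      ultimately have "((\<lambda>t. (exp (- c * t) * k t + (- c * exp (- c * t)) * K t) - exp (- c * t) * k t)
          has_integral exp (- c * T) * K T - exp (- c * 0) * K 0 - A T) {0..T}"
        by (rule has_integral_diff)
      from has_integral_mult_right[OF this, of "- 1 / c"]
      have "((\<lambda>t. - 1 / c * (- c * exp (- c * t) * K t)) has_integral
          - 1 / c * (exp (- c * T) * K T - A T)) {0..T}"
        by (simp add: K_def)
      moreover have "- 1 / c * (- c * exp (- c * t) * K t) = exp (- c * t) * K t" for t
        using c by simp
      moreover have "- 1 / c * (exp (- c * T) * K T - A T) = (A T - exp (- c * T) * K T) / c"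
        using c by (simp add: field_simps)
      ultimately have "((\<lambda>t. exp (- c * t) * K t) has_integral (A T - exp (- c * T) * K T) / c) {0..T}"
        by (simp only:)
      then show ?thesis
        by (rule integral_unique)
    qed
    have "((\<lambda>T. exp (- c * T)) \<longlongrightarrow> 0) at_top"
      using c by (intro filterlim_compose[OF exp_at_bot] filterlim_tendsto_neg_mult_at_bot[OF tendsto_const])
        (auto simp: filterlim_ident)
    then have "((\<lambda>T. (A T - exp (- c * T) * K T) / c) \<longlongrightarrow> (0 - 0 * 0) / c) at_top"
      unfolding A_def using c by (intro tendsto_intros tail K_lim) auto
    then have "((\<lambda>T. (A T - exp (- c * T) * K T) / c) \<longlongrightarrow> 0) at_top"
      by simp
    then show "((\<lambda>T. integral {0..T} (\<lambda>t. exp (- real (Suc n) * t) * K t)) \<longlongrightarrow> 0) at_top"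
      unfolding c_def[symmetric]
      by (rule Lim_transform_eventually)
         (intro eventually_mono[OF eventually_ge_at_top[of 0]] parts[symmetric])
  qed
  \<comment> \<open>\<open>K\<close> vanishes on the half-line and has derivative \<open>k\<close>;
    uniqueness of the derivative on a nondegenerate interval, one-sided when \<open>t = 0\<close>,
    gives \<open>k t = 0\<close>.\<close>
  then have "((\<lambda>_. 0) has_vector_derivative k t) (at t within {0..t + 1})"
    using \<open>t \<ge> 0\<close> by (intro has_vector_derivative_transform[OF _ _ K_deriv]) auto
  moreover have "((\<lambda>_. 0 :: real) has_vector_derivative 0) (at t within {0..t + 1})"
    by simp
  ultimately have "k t = 0"
    using \<open>t \<ge> 0\<close>
    by (intro vector_derivative_unique_within_closed_interval[of 0 "t + 1" t]) (auto simp: cbox_interval)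
  then show ?thesis
    by (simp add: k_def)
qed

lemma laplace_preimage_unique:
  assumes f: "laplace_preimage F f" and g: "laplace_preimage F g" and "t \<ge> 0"
  shows "g t = f t"
proof -
  have transform: "\<forall>\<^sub>F s in at_top. ((\<lambda>t. exp (- s * t) * u t) has_integral F s) {0..}"
    if "laplace_preimage F u" for u
    using that unfolding laplace_preimage_def laplace_transform_def
    by (auto elim!: eventually_mono simp: has_integral_integrable_integral)
  obtain s0 where s0: "\<forall>s\<ge>s0. ((\<lambda>t. exp (- s * t) * f t) has_integral F s) {0..} \<and>
      ((\<lambda>t. exp (- s * t) * g t) has_integral F s) {0..}"
    using eventually_conj[OF transform[OF f] transform[OF g]]
    unfolding eventually_at_top_linorder by blast
  have "g t - f t = 0"
  proof (rule laplace_zero_imp_zero[OF _ _ \<open>t \<ge> 0\<close>])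
    show "continuous_on {0..} (\<lambda>t. g t - f t)"
      using f g unfolding laplace_preimage_def by (intro continuous_intros) auto
    show "((\<lambda>t. exp (- s * t) * (g t - f t)) has_integral 0) {0..}" if "s \<ge> s0" for s
      using has_integral_diff[of "\<lambda>t. exp (- s * t) * g t" "F s" "{0..}" "\<lambda>t. exp (- s * t) * f t" "F s"]
        s0 that by (simp add: right_diff_distrib)
  qed
  then show ?thesis by simp
qed

section \<open>Laplace transforms of powers\<close>

text \<open>Rescale Euler's integral for Gamma by u = s t on each bounded interval, then let the
  upper limit tend to infinity.\<close>

lemma has_integral_powr_exp_minus:
  fixes a s :: real
  assumes a: "a > -1" and s: "s > 0"
  shows "((\<lambda>t. exp (- s * t) * t powr a) has_integral Gamma (a + 1) / s powr (a + 1)) {0..}"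
proof (rule has_integral_to_inf)
  define f where "f = (\<lambda>t::real. t powr a / exp t)"
  have f: "(f has_integral Gamma (a + 1)) {0..}"
    using Gamma_integral_real[of "a + 1"] a by (simp add: f_def)
  have scaled: "((\<lambda>t. exp (- s * t) * t powr a) has_integral
        integral {0..s * y} f / s powr (a + 1)) {0..y}" if "y \<ge> 0" for y
  proof -
    have "f integrable_on {0..s * y}"
      using f by (intro integrable_on_subinterval[of f "{0..}"]) auto
    from has_integral_stretch_real[OF integrable_integral[OF this], of s] s
    have "((\<lambda>t. f (s * t)) has_integral integral {0..s * y} f / s) ((\<lambda>x. x / s) ` {0..s * y})"
      by simp
    also have "(\<lambda>x. x / s) ` {0..s * y} = {0..y}"
      using s that image_mult_atLeastAtMost[of "1 / s" 0 "s * y"] by simp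
    finally have "((\<lambda>t. s powr (- a) * f (s * t)) has_integral
        s powr (- a) * (integral {0..s * y} f / s)) {0..y}"
      by (rule has_integral_mult_right)
    moreover have "s powr (- a) * f (s * t) = exp (- s * t) * t powr a" if "t \<in> {0..y}" for t
      using that s by (simp add: f_def powr_mult powr_minus exp_minus field_simps)
    moreover have "s powr (- a) * (integral {0..s * y} f / s) = integral {0..s * y} f / s powr (a + 1)"
      using s by (simp add: powr_minus powr_add field_simps)
    ultimately show ?thesis
      by (metis (no_types, lifting) has_integral_cong)
  qed
  show "(\<lambda>t. exp (- s * t) * t powr a) integrable_on {0..y}" for y
    using scaled[of y] by (cases "y \<ge> 0") (auto simp: integrable_on_def intro: has_integral_empty)
  have "filterlim (\<lambda>y. s * y) at_top at_top"
    using s by (intro filterlim_tendsto_pos_mult_at_top[OF tendsto_const]) (auto simp: filterlim_ident)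
  moreover have "((\<lambda>y. integral {0..y} f) \<longlongrightarrow> Gamma (a + 1)) at_top"
    using integral_tendsto_at_top[OF has_integral_integrable[OF f]] by (simp add: integral_unique[OF f])
  ultimately have "((\<lambda>y. integral {0..s * y} f) \<longlongrightarrow> Gamma (a + 1)) at_top"
    by (rule filterlim_compose[rotated])
  then have "((\<lambda>y. integral {0..s * y} f / s powr (a + 1)) \<longlongrightarrow> Gamma (a + 1) / s powr (a + 1)) at_top"
    using s by (intro tendsto_divide tendsto_const) auto
  then show "((\<lambda>y. integral {0..y} (\<lambda>t. exp (- s * t) * t powr a)) \<longlongrightarrow>
      Gamma (a + 1) / s powr (a + 1)) at_top"
    by (rule Lim_transform_eventually)
       (intro eventually_mono[OF eventually_ge_at_top[of 0]] integral_unique[OF scaled, symmetric])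
qed simp

text \<open>The integrand uses \<open>(t powr b) ^ k\<close> because \<open>0 powr 0 = 0\<close>: at \<open>t = 0\<close>, \<open>k = 0\<close> it differs
  from \<open>t powr (b * k)\<close>.\<close>

lemma has_integral_powr_power_exp_minus:
  fixes b s :: real
  assumes "b > 0" "s > 0"
  shows "((\<lambda>t. exp (- s * t) * (t powr b) ^ k) has_integral
      Gamma (b * real k + 1) / s powr (b * real k + 1)) {0..}"
proof (rule has_integral_spike_finite[of "{0}"])
  show "((\<lambda>t. exp (- s * t) * t powr (b * real k)) has_integral
      Gamma (b * real k + 1) / s powr (b * real k + 1)) {0..}"
    by (rule has_integral_powr_exp_minus)
       (use assms in \<open>auto intro: less_le_trans[of _ 0]\<close>)
  show "exp (- s * t) * (t powr b) ^ k = exp (- s * t) * t powr (b * real k)" if "t \<in> {0..} - {0}" for t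
    using that by (simp add: powr_powr[symmetric] powr_realpow)
qed simp

section \<open>Convergence, continuity and transform of the Mittag-Leffler series\<close>

text \<open>Keep only the part of Euler's integral beyond \<open>T\<close>, where t^x is at least
  T^x. As \<open>T\<close> is free, Gamma outgrows every exponential, which takes the place of
  Stirling's formula.\<close>

lemma Gamma_lower_bound:
  fixes x T :: real
  assumes "x \<ge> 0" "T > 0"
  shows "exp (- T) * T powr x \<le> Gamma (x + 1)"
proof (rule has_integral_le)
  have "((\<lambda>t. T powr x * exp (- t)) has_integral T powr x * exp (- T)) {T..}"
    using has_integral_exp_minus_to_infinity[of 1 T] by (intro has_integral_mult_right) simp
  moreover have "{T..} \<inter> {0..} = {T..}"
    using assms by auto
  ultimately show "((\<lambda>t. if t \<in> {T..} then exp (- t) * T powr x else 0)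
      has_integral exp (- T) * T powr x) {0..}"
    by (subst has_integral_restrict_Int) (simp add: mult.commute)
  show "((\<lambda>t. t powr x / exp t) has_integral Gamma (x + 1)) {0..}"
    using Gamma_integral_real[of "x + 1"] assms by simp
  show "(if t \<in> {T..} then exp (- t) * T powr x else 0) \<le> t powr x / exp t" for t
    using assms powr_mono2[of x T t] by (simp add: exp_minus divide_inverse mult_left_mono mult.commute)
qed

lemma summable_mittag_leffler:
  fixes b z :: real
  assumes b: "b > 0"
  shows "summable (\<lambda>k. 1 / Gamma (b * real k + 1) * z ^ k)"
proof (rule summable_comparison_test)
  \<comment> \<open>With this \<open>T\<close>, the bound on Gamma beats \<bar>z\<bar>^k with a
    factor 2^k to spare, up to the constant \<open>exp T\<close>. The added 1 keeps \<open>T\<close>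
    positive when \<open>z = 0\<close>.\<close>
  define T where "T = (2 * (\<bar>z\<bar> + 1)) powr (1 / b)"
  have T: "T > 0" "T powr b = 2 * (\<bar>z\<bar> + 1)"
    using b by (auto simp: T_def powr_powr)
  show "summable (\<lambda>k. exp T * (1 / 2 :: real) ^ k)"
    by (intro summable_mult summable_geometric) simp
  have bound: "norm (1 / Gamma (b * real k + 1) * z ^ k) \<le> exp T * (1 / 2) ^ k" for k
  proof -
    have pos: "Gamma (b * real k + 1) > 0"
      using b by (intro Gamma_real_pos) (simp add: add_nonneg_pos)
    have "\<bar>z\<bar> ^ k * 2 ^ k \<le> (T powr b) ^ k"
      unfolding T(2) power_mult_distrib[symmetric] by (intro power_mono) auto
    also have "(T powr b) ^ k = exp T * (exp (- T) * T powr (b * real k))"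
      using T(1) by (simp add: powr_powr[symmetric] powr_realpow exp_minus)
    also have "\<dots> \<le> exp T * Gamma (b * real k + 1)"
      using Gamma_lower_bound[of "b * real k" T] b T(1) by (intro mult_left_mono) auto
    finally show ?thesis
      using pos by (simp add: abs_mult power_abs power_divide pos_divide_le_eq pos_le_divide_eq mult_ac)
  qed
  show "\<exists>N. \<forall>k\<ge>N. norm (1 / Gamma (b * real k + 1) * z ^ k) \<le> exp T * (1 / 2) ^ k"
    using bound by simp
qed

lemma isCont_mittag_leffler:
  fixes b z :: real
  assumes "b > 0"
  shows "isCont (mittag_leffler b) z"
  using isCont_powser_converges_everywhere[OF summable_mittag_leffler[OF assms]]
  by (simp add: mittag_leffler_series[abs_def])

lemma continuous_on_mittag_leffler_powr:
  fixes b c :: real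
  assumes "b > 0"
  shows "continuous_on {0..} (\<lambda>t. mittag_leffler b (c * t powr b))"
proof (rule continuous_on_compose2[of UNIV "mittag_leffler b"])
  show "continuous_on UNIV (mittag_leffler b)"
    using isCont_mittag_leffler[OF assms] by (simp add: continuous_on_eq_continuous_at)
  show "continuous_on {0..} (\<lambda>t. c * t powr b)"
    using assms by (intro continuous_intros continuous_on_powr') auto
qed simp

text \<open>The bound on \<open>c\<close> makes the integrals of the absolute values of the terms a
  convergent geometric series, which justifies exchanging sum and integral.\<close>

lemma has_integral_laplace_mittag_leffler:
  fixes b c s :: real
  assumes b: "b > 0" and s: "s > 0" and c: "\<bar>c\<bar> < s powr b"
  shows "((\<lambda>t. exp (- s * t) * mittag_leffler b (c * t powr b)) has_integral
      s powr b / (s * (s powr b - c))) {0..}"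
proof -
  \<comment> \<open>The parameter \<open>d\<close> lets one formula serve twice: the absolute value
    of the term for \<open>d\<close> is the term for \<bar>d\<bar>.\<close>
  define f where "f = (\<lambda>d k t. exp (- s * t) * (1 / Gamma (b * real k + 1) * (d * t powr b) ^ k))"
  \<comment> \<open>The exchange is carried out for the Lebesgue integral, and the result is then
    carried back to the gauge integral.\<close>
  define M where "M = lebesgue_on {0::real..}"
  have pos: "Gamma (b * real k + 1) > 0" for k
    using b by (intro Gamma_real_pos) (simp add: add_nonneg_pos)
  have f: "(f d k has_integral (d / s powr b) ^ k / s) {0..}" for d k
  proof -
    from has_integral_mult_right[OF has_integral_powr_power_exp_minus[OF b s, of k],
        of "d ^ k / Gamma (b * real k + 1)"]
    have "(f d k has_integral
        d ^ k / Gamma (b * real k + 1) * (Gamma (b * real k + 1) / s powr (b * real k + 1))) {0..}"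
      by (simp add: f_def power_mult_distrib mult_ac)
    also have "d ^ k / Gamma (b * real k + 1) * (Gamma (b * real k + 1) / s powr (b * real k + 1))
        = (d / s powr b) ^ k / s"
      using pos[of k] s by (simp add: powr_add powr_powr[symmetric] powr_realpow power_divide)
    finally show ?thesis .
  qed
  have abs_f: "norm (f d k t) = f \<bar>d\<bar> k t" for d k t
    using pos[of k] by (simp add: f_def abs_mult power_abs)
  have f_abs_int: "f d k absolutely_integrable_on {0..}" for d k
    using f[of d k] f[of "\<bar>d\<bar>" k] unfolding abs_f[symmetric]
    by (blast intro: absolutely_integrable_onI has_integral_integrable)
  then have f_int: "integrable M (f d k)" for d k
    by (simp add: M_def integrable_restrict_space set_integrable_def)
  have f_lint: "integral\<^sup>L M (f d k) = (d / s powr b) ^ k / s" for d k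
    using f_int[of d k] f[of d k]
    by (simp add: M_def lebesgue_integral_eq_integral integral_unique)
  have ratio: "norm (c / s powr b) < 1"
    using c s by (simp add: divide_less_eq)
  have summable_f: "summable (\<lambda>k. norm (f c k t))" for t
    unfolding abs_f unfolding f_def
    by (intro summable_mult summable_mittag_leffler b)
  have "summable (\<lambda>k. \<integral>t. norm (f c k t) \<partial>M)"
    unfolding abs_f f_lint using ratio
    by (intro summable_divide summable_geometric) simp
  note termwise = f_int[of c] AE_I2[OF summable_f] this
  have "integral\<^sup>L M (\<lambda>t. \<Sum>k. f c k t) = (\<Sum>k. (c / s powr b) ^ k / s)"
    using integral_suminf[OF termwise] by (simp add: f_lint)
  also have "\<dots> = 1 / (1 - c / s powr b) / s"
    using suminf_divide[OF summable_geometric[OF ratio], of s] by (simp add: suminf_geometric[OF ratio])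
  also have "\<dots> = s powr b / (s * (s powr b - c))"
    using c s by (simp add: field_simps)
  finally have "((\<lambda>t. \<Sum>k. f c k t) has_integral s powr b / (s * (s powr b - c))) {0..}"
    using has_integral_integral_lebesgue_on[OF integrable_suminf[OF termwise, unfolded M_def]]
    by (simp add: M_def)
  also have "(\<lambda>t. \<Sum>k. f c k t) = (\<lambda>t. exp (- s * t) * mittag_leffler b (c * t powr b))"
  proof
    fix t
    show "(\<Sum>k. f c k t) = exp (- s * t) * mittag_leffler b (c * t powr b)"
      unfolding f_def mittag_leffler_series
      using suminf_mult[OF summable_mittag_leffler[OF b, of "c * t powr b"]] by simp
  qed
  finally show ?thesis .
qed

section \<open>The inverse transform\<close>

theorem proposition2:
  fixes \<Lambda>\<^sub>0 \<alpha> \<gamma> \<beta> :: real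
  assumes "\<Lambda>\<^sub>0 > 0" and "0 < \<alpha>" "\<alpha> < 1" and "\<gamma> > 0" and "0 < \<beta>" "\<beta> < 1"
  shows "is_inverse_laplace
           (\<lambda>s. \<Lambda>\<^sub>0 / s * ((\<gamma> + s powr \<beta>) / ((1 - \<alpha>) * \<gamma> + s powr \<beta>)))
           (\<lambda>t. \<Lambda>\<^sub>0 / (1 - \<alpha>)
                - \<alpha> * \<Lambda>\<^sub>0 / (1 - \<alpha>) * mittag_leffler \<beta> ((\<alpha> - 1) * \<gamma> * t powr \<beta>))"
    (is "is_inverse_laplace ?F ?f")
proof -
  define c where "c = (1 - \<alpha>) * \<gamma>"
  have c: "c > 0"
    using assms by (simp add: c_def)
  \<comment> \<open>The Mittag-Leffler argument has coefficient \<open>- c\<close>, so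
    \<open>s powr \<beta> > c\<close> is exactly the convergence condition of its transform.\<close>
  have transform: "((\<lambda>t. exp (- s * t) * ?f t) has_integral ?F s) {0..}"
    if s: "s > 0" "s powr \<beta> > c" for s
  proof -
    have "((\<lambda>t. exp (- s * t) * mittag_leffler \<beta> (- c * t powr \<beta>)) has_integral
        s powr \<beta> / (s * (s powr \<beta> - - c))) {0..}"
      using assms s c by (intro has_integral_laplace_mittag_leffler) auto
    moreover have "((\<lambda>t. exp (- s * t)) has_integral 1 / s) {0..}"
      using has_integral_exp_minus_to_infinity[of s 0] s by simp
    ultimately have "((\<lambda>t. \<Lambda>\<^sub>0 / (1 - \<alpha>) * exp (- s * t) -
        \<alpha> * \<Lambda>\<^sub>0 / (1 - \<alpha>) * (exp (- s * t) * mittag_leffler \<beta> (- c * t powr \<beta>))) has_integral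
        \<Lambda>\<^sub>0 / (1 - \<alpha>) * (1 / s) - \<alpha> * \<Lambda>\<^sub>0 / (1 - \<alpha>) * (s powr \<beta> / (s * (s powr \<beta> - - c)))) {0..}"
      by (intro has_integral_diff has_integral_mult_right)
    moreover have "\<Lambda>\<^sub>0 / (1 - \<alpha>) * exp (- s * t) -
        \<alpha> * \<Lambda>\<^sub>0 / (1 - \<alpha>) * (exp (- s * t) * mittag_leffler \<beta> (- c * t powr \<beta>)) =
        exp (- s * t) * ?f t" for t
    proof -
      have "- c * t powr \<beta> = (\<alpha> - 1) * \<gamma> * t powr \<beta>"
        by (simp add: c_def algebra_simps)
      then show ?thesis
        by (simp add: right_diff_distrib mult_ac)
    qed
    moreover have "\<Lambda>\<^sub>0 / (1 - \<alpha>) * (1 / s) - \<alpha> * \<Lambda>\<^sub>0 / (1 - \<alpha>) * (s powr \<beta> / (s * (s powr \<beta> - - c))) = ?F s"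
    proof -
      \<comment> \<open>Treating the power as an atom leaves an identity of rational functions, in
        which the factor 1 - \<alpha> cancels.\<close>
      define w where "w = s powr \<beta>"
      have "w + c \<noteq> 0" "1 - \<alpha> \<noteq> 0" "s \<noteq> 0"
        using s c assms by (auto simp: w_def)
      moreover from this have "\<Lambda>\<^sub>0 / (1 - \<alpha>) * (1 / s) - \<alpha> * \<Lambda>\<^sub>0 / (1 - \<alpha>) * (w / (s * (w - - c))) =
          \<Lambda>\<^sub>0 * ((w + c) - \<alpha> * w) / ((1 - \<alpha>) * s * (w + c))"
        by (simp add: divide_simps) (simp add: algebra_simps)
      moreover have "(w + c) - \<alpha> * w = (1 - \<alpha>) * (\<gamma> + w)"
        by (simp add: c_def algebra_simps)
      ultimately show ?thesis
        unfolding w_def[symmetric] c_def[symmetric] by (simp add: add.commute)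
    qed
    ultimately show ?thesis
      by (simp only:)
  qed
  have "\<forall>\<^sub>F s in at_top. s powr \<beta> > c"
    using eventually_gt_at_top[of "c powr (1 / \<beta>)"]
  proof eventually_elim
    case (elim s)
    then have "(c powr (1 / \<beta>)) powr \<beta> < s powr \<beta>"
      using assms by (intro powr_less_mono2) auto
    then show ?case
      using assms c by (simp add: powr_powr)
  qed
  then have "\<forall>\<^sub>F s in at_top. ((\<lambda>t. exp (- s * t) * ?f t) has_integral ?F s) {0..}"
    using eventually_gt_at_top[of 0] by eventually_elim (rule transform)
  moreover have "continuous_on {0..} ?f"
    by (intro continuous_intros continuous_on_mittag_leffler_powr assms)
  ultimately have "laplace_preimage ?F ?f"
    unfolding laplace_preimage_def laplace_transform_def
    by (auto elim!: eventually_mono intro: has_integral_integrable integral_unique)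
  then show ?thesis
    unfolding is_inverse_laplace_def using laplace_preimage_unique by blast
qed

end
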